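(* Let $a, b, m \in \mathbb{Z}$ with $a+b+1=m^2$. Let $f(x)=x^2+ax+b$ and $P(k)=f\big(f(k)+k\big)=f(k)f(k+1)$. Then the diophantine equation $$\prod_{k=1}^{n} P(k)=y^2,$$ in the unknowns $n$ (a positive integer) and $y\in\mathbb{Z}$, has finitely many solutions.
   Context: For integers $a,b$ and $f(x)=x^2+ax+b$, the identity $f\big(f(x)+x\big)=f(x)f(x+1)$ holds, so the two expressions given for $P(k)$ agree. Here $P$ is a monic polynomial of degree four with integer coefficients.
   Formalization: Two hypotheses are added: a² ≠ 4b, and f(k) ≠ 0 for every integer k ≥ 1; without either one there are infinitely many solutions (e.g. a=2, b=1, m=2, or a=-7, b=10, m=2). *)

theory Defs
  imports Main
begin

definition quad :: "int \<Rightarrow> int \<Rightarrow> int \<Rightarrow> int" where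
  "quad a b x = x^2 + a * x + b"

definition quartic :: "int \<Rightarrow> int \<Rightarrow> int \<Rightarrow> int" where
  "quartic a b k = quad a b (quad a b k + k)"

lemma quartic_eq_prod: "quartic a b k = quad a b k * quad a b (k + 1)"
  by (simp add: quartic_def quad_def power2_eq_square algebra_simps)

definition solutions :: "int \<Rightarrow> int \<Rightarrow> (nat \<times> int) set" where
  "solutions a b = {(n, y). n \<ge> 1 \<and> (\<Prod>k = 1..n. quartic a b (int k)) = y^2}"

text \<open>
  The condition \<open>a + b + 1 = m^2\<close> alone does not imply finiteness: if \<open>quad a b\<close> is the
  square of a linear polynomial, or has a positive integer zero, then there are infinitely many
  solutions. The lemmas below show that both cases have to be excluded and that both occur under
  that condition.
\<close>

lemma infinite_solutionsI:
  assumes "\<And>n. n \<ge> N \<Longrightarrow> \<exists>y. (n, y) \<in> solutions a b"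
  shows "infinite (solutions a b)"
proof
  assume "finite (solutions a b)"
  hence "finite (fst ` solutions a b)" by simp
  moreover have "{N..} \<subseteq> fst ` solutions a b"
    using assms by force
  ultimately have "finite {N..}" by (rule rev_finite_subset)
  thus False by (simp add: infinite_Ici)
qed

lemma infinite_solutions_if_square:
  assumes "a^2 = 4 * b"
  shows "infinite (solutions a b)"
proof (rule infinite_solutionsI[of 1])
  fix n :: nat assume n: "n \<ge> 1"
  have "even (a^2)" using assms by simp
  then obtain c where c: "a = 2 * c" by auto
  have "b = c^2" using assms c by (simp add: power2_eq_square)
  hence "quad a b x = (x + c)^2" for x
    using c by (simp add: quad_def power2_eq_square algebra_simps)
  hence "(\<Prod>k = 1..n. quartic a b (int k)) = (\<Prod>k = 1..n. (int k + c) * (int k + 1 + c))^2"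
    by (simp add: quartic_eq_prod power_mult_distrib prod_power_distrib)
  thus "\<exists>y. (n, y) \<in> solutions a b"
    using n unfolding solutions_def by blast
qed

lemma infinite_solutions_if_zero:
  assumes "k \<ge> 1" "quad a b k = 0"
  shows "infinite (solutions a b)"
proof (rule infinite_solutionsI[of "nat k"])
  fix n assume n: "n \<ge> nat k"
  have "quartic a b (int (nat k)) = 0" using assms by (simp add: quartic_eq_prod)
  moreover have "nat k \<in> {1..n}" using n assms by auto
  ultimately have "(\<Prod>k = 1..n. quartic a b (int k)) = 0"
    by (intro prod_zero bexI[of _ "nat k"]) simp_all
  hence "(n, 0) \<in> solutions a b"
    using n assms by (auto simp: solutions_def)
  thus "\<exists>y. (n, y) \<in> solutions a b" by blast
qed

lemma square_case_occurs:
  "\<exists>a b m :: int. a + b + 1 = m^2 \<and> (\<forall>k\<ge>1. quad a b k \<noteq> 0) \<and> infinite (solutions a b)"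
proof (intro exI conjI)
  show "2 + 1 + 1 = (2 :: int)^2" by simp
  show "\<forall>k\<ge>1. quad 2 1 k \<noteq> 0"
    by (auto simp: quad_def add_pos_pos less_imp_neq[symmetric])
  show "infinite (solutions 2 1)" by (rule infinite_solutions_if_square) simp
qed

lemma zero_case_occurs:
  "\<exists>a b m :: int. a + b + 1 = m^2 \<and> m \<noteq> 0 \<and> a^2 \<noteq> 4 * b \<and> infinite (solutions a b)"
proof (intro exI conjI)
  show "-7 + 10 + 1 = (2 :: int)^2" by simp
  show "infinite (solutions (-7) 10)"
    by (rule infinite_solutions_if_zero[of 2]) (simp_all add: quad_def)
qed simp_all

end

theory Submission
  imports Defs
begin

text \<open>
  Write \<open>f\<close> for \<^term>\<open>quad a b\<close>. Since \<open>P(k) = f(k) f(k + 1)\<close>, every value of \<open>f\<close> strictly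
  between the two ends occurs twice in \<open>P(1) \<cdots> P(n)\<close>, so that product is \<open>f(1) f(n + 1)\<close> up to
  a square. As \<open>f(1) = a + b + 1\<close> is a square and no value of \<open>f\<close> involved vanishes, a
  solution \<open>(n, y)\<close> makes \<open>f(n + 1)\<close> the square of an integer
  (\<open>prod_quartic_telescope\<close>, \<open>quad_eq_square_of_solution\<close>).

  A quadratic with nonzero discriminant \<open>D\<close> takes square values at only finitely many integers:
  completing the square turns \<open>f(x) = z\<^sup>2\<close> into a factorization of \<open>D\<close> into two integers with
  sum \<open>2(2x + a)\<close>, which bounds \<open>x\<close> (\<open>quad_eq_square_bound\<close>). Hence \<open>n\<close> is bounded, and each
  \<open>n\<close> admits finitely many \<open>y\<close>.
\<close>

text \<open>
  The factor \<open>f(1)\<close> on the left completes the shifted product \<open>f(2) \<cdots> f(n + 1)\<close> to one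
  that starts at \<open>f(1)\<close>; this keeps the identity free of division.
\<close>

lemma prod_quartic_telescope:
  "quad a b 1 * (\<Prod>k = 1..n. quartic a b (int k))
     = (\<Prod>k = 1..n. quad a b (int k))^2 * quad a b (int n + 1)"
proof (induction n)
  case 0
  show ?case by simp
next
  case (Suc n)
  have "quad a b 1 * (\<Prod>k = 1..Suc n. quartic a b (int k))
      = quad a b 1 * (\<Prod>k = 1..n. quartic a b (int k)) * quartic a b (int n + 1)"
    by (simp add: ac_simps)
  also have "\<dots> = (\<Prod>k = 1..n. quad a b (int k))^2 * quad a b (int n + 1)
      * (quad a b (int n + 1) * quad a b (int n + 1 + 1))"
    by (simp only: Suc.IH, simp only: quartic_eq_prod)
  also have "\<dots> = (\<Prod>k = 1..Suc n. quad a b (int k))^2 * quad a b (int (Suc n) + 1)"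
    by (simp add: power2_eq_square ac_simps)
  finally show ?case .
qed

lemma quad_eq_square_of_solution:
  assumes "quad a b 1 = m^2"
    and nonzero: "\<forall>k\<ge>1. quad a b k \<noteq> 0"
    and "(n, y) \<in> solutions a b"
  obtains z where "quad a b (int n + 1) = z^2"
proof -
  define F where "F = (\<Prod>k = 1..n. quad a b (int k))"
  have "F \<noteq> 0"
    using nonzero by (simp add: F_def)
  have eq: "(m * y)^2 = F^2 * quad a b (int n + 1)"
    using prod_quartic_telescope[of a b n] assms(1,3)
    by (simp add: F_def solutions_def power_mult_distrib)
  then have "F^2 dvd (m * y)^2"
    by simp
  then have "F dvd m * y"
    by (simp add: pow_divides_pow_iff)
  then obtain z where "m * y = F * z" ..
  then have "quad a b (int n + 1) = z^2"
    using eq \<open>F \<noteq> 0\<close> by (simp add: power_mult_distrib)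
  then show thesis by (rule that)
qed

text \<open>
  With \<open>D = a\<^sup>2 - 4b\<close>, the equation reads \<open>(2x + a - 2z)(2x + a + 2z) = D\<close>. If \<open>D \<noteq> 0\<close>, both
  factors divide \<open>D\<close> and so are at most \<open>\<bar>D\<bar>\<close> in absolute value.
\<close>

lemma quad_eq_square_bound:
  assumes "a^2 \<noteq> 4 * b" and "quad a b x = z^2"
  shows "\<bar>2 * x + a\<bar> \<le> \<bar>a^2 - 4 * b\<bar>"
proof -
  define D where "D = a^2 - 4 * b"
  define p q where "p = 2 * x + a - 2 * z" and "q = 2 * x + a + 2 * z"
  have pq: "p * q = D"
    using assms(2) by (simp add: D_def p_def q_def quad_def power2_eq_square algebra_simps)
  have "D \<noteq> 0" using assms(1) by (simp add: D_def)
  have "p dvd D" "q dvd D"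
    by (simp_all flip: pq)
  then have "\<bar>p\<bar> \<le> \<bar>D\<bar>" "\<bar>q\<bar> \<le> \<bar>D\<bar>"
    using \<open>D \<noteq> 0\<close> by (simp_all add: dvd_imp_le_int)
  moreover have "2 * (2 * x + a) = p + q"
    by (simp add: p_def q_def)
  ultimately show ?thesis
    unfolding D_def by (auto simp: abs_le_iff)
qed

lemma finite_int_square_roots: "finite {y :: int. y^2 = c}"
proof (rule finite_subset)
  show "{y :: int. y^2 = c} \<subseteq> {- c..c}"
  proof
    fix y :: int assume "y \<in> {y. y^2 = c}"
    moreover have "\<bar>y\<bar> \<le> y^2"
      using self_le_power[of "\<bar>y\<bar>" 2] by (cases "y = 0") auto
    ultimately show "y \<in> {- c..c}" by auto
  qed
qed simp

theorem mainTheorem1: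
  fixes a b m :: int
  assumes "a + b + 1 = m^2"
    and "a^2 \<noteq> 4 * b"
    and "\<forall>k\<ge>1. quad a b k \<noteq> 0"
  shows "finite (solutions a b)"
proof -
  let ?N = "nat (\<bar>a^2 - 4 * b\<bar> + \<bar>a\<bar>)"
  let ?Y = "\<lambda>n. {y. y^2 = (\<Prod>k = 1..n. quartic a b (int k))}"
  have "solutions a b \<subseteq> Sigma {..?N} ?Y"
  proof
    fix s assume s: "s \<in> solutions a b"
    obtain n y where [simp]: "s = (n, y)" by (cases s)
    have "quad a b 1 = m^2"
      using assms(1) by (simp add: quad_def)
    then obtain z where "quad a b (int n + 1) = z^2"
      using quad_eq_square_of_solution[of a b m n y] assms(3) s by auto
    then have "\<bar>2 * (int n + 1) + a\<bar> \<le> \<bar>a^2 - 4 * b\<bar>"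
      by (rule quad_eq_square_bound[OF assms(2)])
    then have "n \<le> ?N"
      by (simp add: le_nat_iff)
    then show "s \<in> Sigma {..?N} ?Y"
      using s by (simp add: solutions_def)
  qed
  moreover have "finite (Sigma {..?N} ?Y)"
    by (simp add: finite_int_square_roots)
  ultimately show ?thesis by (rule finite_subset)
qed

end
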